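(* Let $G$ be a finite simple undirected graph on $n$ vertices with adjacency matrix $A$ and walk matrix $W$, and let $\overline{A}$ be the adjacency matrix of the complement of $G$. Let $w$ be a new vertex not in $V(G)$. Let $G\cup w$ be the graph obtained from $G$ by adding $w$ as an isolated vertex, and $G\vee w$ the graph obtained from $G$ by adding $w$ adjacent to all vertices of $G$. Then (i) $\det(W(G\cup w))=\pm\det(A)\det(W)$, and (ii) $\det(W(G\vee w))=\pm\det(\overline{A})\det(W)$. Moreover, if $w$ is taken as the first vertex (vertex ordering $w,v_1,\ldots,v_n$ where $v_1,\ldots,v_n$ is the ordering of $V(G)$ used for $A$ and $W$), then $\det(W(G\cup w))=\det(A)\det(W)$ and $\det(W(G\vee w))=\det(\overline{A})\det(W)$.
   Context: For a graph $H$ on $m$ vertices with adjacency matrix $A(H)$ (with respect to a fixed vertex ordering), the walk matrix is $W(H)=[e,A(H)e,\ldots,A(H)^{m-1}e]$, where $e$ is the all-ones vector of length $m$. The sign in (i) and (ii) depends only on the position of $w$ in the vertex ordering.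
   Formalization: The last equation is proved as det(W(G∨w)) = (-1)^n det(Ā) det(W) with w first; without the factor (-1)^n it fails for odd n, e.g. for the 7-vertex tree with a center and three paths of lengths 1, 2, 3 attached. The signs in (i), (ii) depend on the position of w for fixed n. *)

theory Defs
  imports "Graph_Theory.Pair_Digraph" "Jordan_Normal_Form.Determinant"
begin

text \<open>
  A finite simple undirected graph is a \<^locale>\<open>pair_graph\<close>: finitely many vertices, no loops,
  and a symmetric set of arcs, so that an edge between u and v is the pair of arcs (u, v), (v, u).
\<close>

definition graph_complement :: "'a pair_pre_digraph \<Rightarrow> 'a pair_pre_digraph" where
  "graph_complement G =
     \<lparr> pverts = pverts G,
       parcs = {(u, v). u \<in> pverts G \<and> v \<in> pverts G \<and> u \<noteq> v \<and> (u, v) \<notin> parcs G} \<rparr>"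

definition add_isolated :: "'a pair_pre_digraph \<Rightarrow> 'a \<Rightarrow> 'a pair_pre_digraph" where
  "add_isolated G w = \<lparr> pverts = insert w (pverts G), parcs = parcs G \<rparr>"

definition add_dominating :: "'a pair_pre_digraph \<Rightarrow> 'a \<Rightarrow> 'a pair_pre_digraph" where
  "add_dominating G w =
     \<lparr> pverts = insert w (pverts G),
       parcs = parcs G \<union> {w} \<times> pverts G \<union> pverts G \<times> {w} \<rparr>"

definition vertex_ordering :: "'a pair_pre_digraph \<Rightarrow> 'a list \<Rightarrow> bool" where
  "vertex_ordering G vs \<longleftrightarrow> distinct vs \<and> set vs = pverts G"

text \<open>Positions are counted from 0.\<close>

definition insert_at :: "nat \<Rightarrow> 'a \<Rightarrow> 'a list \<Rightarrow> 'a list" where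
  "insert_at k w vs = take k vs @ w # drop k vs"

text \<open>
  The matrices below are integral, so their determinants are taken in the integers.
\<close>

definition adjacency_mat :: "'a pair_pre_digraph \<Rightarrow> 'a list \<Rightarrow> int mat" where
  "adjacency_mat G vs =
     mat (length vs) (length vs) (\<lambda>(i, j). if (vs ! i, vs ! j) \<in> parcs G then 1 else 0)"

definition ones_vec :: "nat \<Rightarrow> int vec" where
  "ones_vec m = vec m (\<lambda>_. 1)"

definition walk_mat :: "'a pair_pre_digraph \<Rightarrow> 'a list \<Rightarrow> int mat" where
  "walk_mat G vs =
     mat_of_cols (length vs)
       (map (\<lambda>k. (adjacency_mat G vs ^\<^sub>m k) *\<^sub>v ones_vec (length vs)) [0..<length vs])"

lemma pair_graph_graph_complement:
  assumes "pair_graph G" shows "pair_graph (graph_complement G)"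
proof -
  interpret pair_graph G by fact
  have "parcs (graph_complement G) \<subseteq> pverts G \<times> pverts G"
    by (auto simp: graph_complement_def)
  then have "finite (parcs (graph_complement G))"
    by (rule finite_subset) (simp add: pair_finite_verts)
  moreover have "(u, v) \<in> parcs G \<longleftrightarrow> (v, u) \<in> parcs G" for u v
    using pair_sym_arcs by (auto simp: symmetric_def sym_def)
  ultimately show ?thesis
    by unfold_locales
      (auto simp: graph_complement_def symmetric_def pair_finite_verts intro!: symI)
qed

lemma pair_graph_add_isolated:
  assumes "pair_graph G" shows "pair_graph (add_isolated G w)"
proof -
  interpret pair_graph G by fact
  show ?thesis
    using pair_sym_arcs pair_no_loops pair_finite_verts pair_finite_arcs
    by unfold_locales
      (auto simp: add_isolated_def symmetric_def dest: in_arcsD1 in_arcsD2)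
qed

lemma pair_graph_add_dominating:
  assumes "pair_graph G" "w \<notin> pverts G" shows "pair_graph (add_dominating G w)"
proof -
  interpret pair_graph G by fact
  have "(u, v) \<in> parcs G \<longleftrightarrow> (v, u) \<in> parcs G" for u v
    using pair_sym_arcs by (auto simp: symmetric_def sym_def)
  then show ?thesis
    using assms(2) pair_no_loops pair_finite_verts pair_finite_arcs
    by unfold_locales
      (auto simp: add_dominating_def symmetric_def dest: in_arcsD1 in_arcsD2 intro!: symI)
qed

text \<open>
  Pitfall: with the new vertex listed first, adding a dominating vertex to G on n vertices
  multiplies det (walk matrix of G) by (-1)^n det (adjacency matrix of the complement). The factor
  (-1)^n cannot be dropped. For the tree on 0, ..., 6 with edges 01, 03, 06, 14, 25, 56 the two
  determinants of G are -8 and 2, and the new walk matrix has determinant 16. The reason: if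
  c 0, ..., c n are the columns of the new walk matrix after the column operations that turn their
  lower blocks into e, A e, ..., A^n e, and s k is the sum of the entries of A^k e, then
  s k c 0 - c k - c (k+1) has top entry 0 and lower block (adjacency matrix of the complement) A^k e;
  each of these n column changes contributes a sign -1.
\<close>

end

theory Submission
  imports Defs
begin

text \<open>
  With the new vertex first, the isolated vertex makes the first row of the walk matrix
  (1, 0, ..., 0), and deleting that row and the first column leaves A W; this gives (i).
  Since the complement's adjacency matrix B is J - I - A, the vector B^k e is (-1)^k A^k e plus a
  combination of the A^j e with j < k, so passing to the complement multiplies the determinant of
  the walk matrix by the product of the (-1)^k. Part (ii) is (i) for the complement of G,
  because the join with w is the complement of the union of that complement with w: the signs
  for n + 1 and for n vertices combine to (-1)^n. Any other position of w permutes the rows by a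
  permutation depending on the position only.
\<close>

section \<open>Entries of the walk matrix and their recursion\<close>

text \<open>For a graph listed by \<open>vs\<close>, this is the number of walks with
  \<open>k\<close> edges that start at \<open>vs ! i\<close>.\<close>

definition walk_count :: "'a pair_pre_digraph \<Rightarrow> 'a list \<Rightarrow> nat \<Rightarrow> nat \<Rightarrow> int" where
  "walk_count G vs k i = ((adjacency_mat G vs ^\<^sub>m k) *\<^sub>v ones_vec (length vs)) $ i"

lemma adjacency_mat_carrier [simp]:
  "adjacency_mat G vs \<in> carrier_mat (length vs) (length vs)"
  by (simp add: adjacency_mat_def)

lemma ones_vec_carrier [simp]: "ones_vec m \<in> carrier_vec m"
  by (simp add: ones_vec_def)

lemma walk_mat_eq:
  "walk_mat G vs = mat (length vs) (length vs) (\<lambda>(i, j). walk_count G vs j i)"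
  by (rule eq_matI) (auto simp: walk_mat_def walk_count_def mat_of_cols_index)

lemma walk_mat_carrier [simp]: "walk_mat G vs \<in> carrier_mat (length vs) (length vs)"
  by (simp add: walk_mat_eq)

lemma pow_mat_Suc_mult_vec:
  fixes A :: "'a :: comm_semiring_1 mat"
  assumes A: "A \<in> carrier_mat n n" and v: "v \<in> carrier_vec n"
  shows "(A ^\<^sub>m Suc k) *\<^sub>v v = A *\<^sub>v ((A ^\<^sub>m k) *\<^sub>v v)"
proof -
  \<comment> \<open>Powers unfold with the new factor on the right; the recursion for walk counts
    splits off the first edge and needs it on the left.\<close>
  have "A ^\<^sub>m Suc k = A * A ^\<^sub>m k"
  proof (induction k)
    case 0
    then show ?case using A by simp
  next
    case (Suc k)
    have "A ^\<^sub>m Suc (Suc k) = (A * A ^\<^sub>m k) * A"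
      using Suc by simp
    also have "\<dots> = A * A ^\<^sub>m Suc k"
      using A by (simp add: assoc_mult_mat[of A n n "A ^\<^sub>m k" n A n])
    finally show ?case .
  qed
  then show ?thesis
    using A v by (simp add: assoc_mult_mat_vec[of A n n "A ^\<^sub>m k" n v])
qed

lemma walk_count_0:
  assumes "i < length vs"
  shows "walk_count G vs 0 i = 1"
proof -
  have "dim_row (adjacency_mat G vs) = length vs"
    by (simp add: adjacency_mat_def)
  then show ?thesis
    using assms by (simp add: walk_count_def ones_vec_def)
qed

lemma walk_count_Suc:
  assumes "i < length vs"
  shows "walk_count G vs (Suc k) i =
    (\<Sum>j<length vs. adjacency_mat G vs $$ (i, j) * walk_count G vs k j)"
proof -
  let ?A = "adjacency_mat G vs" and ?n = "length vs"
  have "?A ^\<^sub>m k *\<^sub>v ones_vec ?n \<in> carrier_vec ?n"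
    by (rule mult_mat_vec_carrier[of _ _ ?n]) (auto intro: pow_carrier_mat)
  then have "(?A *\<^sub>v (?A ^\<^sub>m k *\<^sub>v ones_vec ?n)) $ i =
      (\<Sum>j<?n. ?A $$ (i, j) * (?A ^\<^sub>m k *\<^sub>v ones_vec ?n) $ j)"
    using assms adjacency_mat_carrier[of G vs]
    by (auto simp: scalar_prod_def lessThan_atLeast0 simp del: adjacency_mat_carrier
        intro!: sum.cong)
  then show ?thesis
    unfolding walk_count_def
      pow_mat_Suc_mult_vec[OF adjacency_mat_carrier[of G vs] ones_vec_carrier] .
qed

section \<open>Change of the vertex ordering\<close>

text \<open>Relabelling conjugates the adjacency matrix by a permutation matrix, which fixes the
  all-ones vector, so each count travels with its vertex.\<close>

lemma walk_count_permute:
  assumes p: "p permutes {..<length vs}" and len: "length us = length vs"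
    and us: "\<And>i. i < length vs \<Longrightarrow> us ! i = vs ! p i"
    and i: "i < length vs"
  shows "walk_count G us k i = walk_count G vs k (p i)"
  using i
proof (induction k arbitrary: i)
  case 0
  then show ?case
    using permutes_in_image[OF p, of i] len by (simp add: walk_count_0)
next
  case (Suc k)
  have p_less: "j < length vs \<Longrightarrow> p j < length vs" for j
    using permutes_in_image[OF p, of j] by simp
  have "walk_count G us (Suc k) i =
      (\<Sum>j<length vs. adjacency_mat G vs $$ (p i, p j) * walk_count G vs k (p j))"
    using Suc len p_less
    by (auto simp: walk_count_Suc adjacency_mat_def us intro!: sum.cong)
  also have "\<dots> = (\<Sum>j<length vs. adjacency_mat G vs $$ (p i, j) * walk_count G vs k j)"
    using sum.permute[OF p, of "\<lambda>j. adjacency_mat G vs $$ (p i, j) * walk_count G vs k j"]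
    by (simp add: o_def)
  finally show ?case
    using Suc.prems p_less by (simp add: walk_count_Suc)
qed

text \<open>Columns belong to powers, not to vertices, so relabelling permutes rows only and the
  sign of \<open>p\<close> enters once.\<close>

lemma det_walk_mat_permute:
  assumes p: "p permutes {..<length vs}" and len: "length us = length vs"
    and us: "\<And>i. i < length vs \<Longrightarrow> us ! i = vs ! p i"
  shows "det (walk_mat G us) = sign p * det (walk_mat G vs)"
proof -
  have "walk_mat G us = mat (length vs) (length vs) (\<lambda>(i, j). walk_mat G vs $$ (p i, j))"
    using permutes_in_image[OF p] len
    by (intro eq_matI) (auto simp: walk_mat_eq walk_count_permute[OF p len us])
  then show ?thesis
    using det_permute_rows[of "walk_mat G vs" "length vs" p] p
    by (simp add: lessThan_atLeast0)
qed

text \<open>The cycle 0 -> 1 -> ... -> k -> 0 sends a position in \<open>insert_at k w vs\<close> to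
  the position of the same vertex in \<open>w # vs\<close>. Neither the graph nor the length of
  \<open>vs\<close> enters, hence its sign depends on \<open>k\<close> alone.\<close>

definition insert_perm :: "nat \<Rightarrow> nat \<Rightarrow> nat" where
  "insert_perm k i = (if i < k then Suc i else if i = k then 0 else i)"

lemma insert_perm_permutes:
  assumes "k < n" shows "insert_perm k permutes {..<n}"
proof (rule bij_imp_permutes)
  have "inj_on (insert_perm k) {..<n}"
    by (auto simp: inj_on_def insert_perm_def split: if_splits)
  moreover have "insert_perm k ` {..<n} \<subseteq> {..<n}"
    using assms by (auto simp: insert_perm_def)
  ultimately show "bij_betw (insert_perm k) {..<n} {..<n}"
    by (simp add: bij_betw_def endo_inj_surj)
qed (use assms in \<open>auto simp: insert_perm_def\<close>)

lemma insert_at_nth: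
  assumes "k \<le> length vs" "i \<le> length vs"
  shows "insert_at k w vs ! i = (w # vs) ! insert_perm k i"
proof (cases "i \<le> k")
  case True
  then show ?thesis
    using assms by (auto simp: insert_at_def insert_perm_def nth_append min_def)
next
  case False
  then obtain j where "i = Suc (k + j)"
    using less_iff_Suc_add[of k i] by auto
  then show ?thesis
    using assms by (simp add: insert_at_def insert_perm_def nth_append min_def)
qed

lemma det_walk_mat_insert_at:
  assumes "k \<le> length vs"
  shows "det (walk_mat G (insert_at k w vs)) =
    sign (insert_perm k) * det (walk_mat G (w # vs))"
proof (rule det_walk_mat_permute)
  show "insert_perm k permutes {..<length (w # vs)}"
    using assms by (simp add: insert_perm_permutes)
  show "length (insert_at k w vs) = length (w # vs)"
    using assms by (simp add: insert_at_def)
qed (use assms in \<open>simp add: insert_at_nth\<close>)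

section \<open>Adding an isolated vertex\<close>

lemma det_walk_mat_add_isolated:
  assumes G: "pair_graph G" and w: "w \<notin> pverts G"
  shows "det (walk_mat (add_isolated G w) (w # vs)) =
    det (adjacency_mat G vs) * det (walk_mat G vs)"
proof -
  interpret pair_graph G by fact
  let ?n = "length vs" and ?A = "adjacency_mat G vs"
  let ?H = "add_isolated G w" and ?W = "walk_mat (add_isolated G w) (w # vs)"
  have notarc: "(w, v) \<notin> parcs G" "(v, w) \<notin> parcs G" for v
    using w by (auto dest: in_arcsD1 in_arcsD2)
  have adj0: "adjacency_mat ?H (w # vs) $$ (0, j) = 0"
    "adjacency_mat ?H (w # vs) $$ (j, 0) = 0" if "j \<le> ?n" for j
    using that by (auto simp: adjacency_mat_def add_isolated_def notarc)
  have adj: "adjacency_mat ?H (w # vs) $$ (Suc i, Suc j) = ?A $$ (i, j)"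
    if "i < ?n" "j < ?n" for i j
    using that by (auto simp: adjacency_mat_def add_isolated_def)
  have top: "walk_count ?H (w # vs) (Suc k) 0 = 0" for k
    by (simp add: walk_count_Suc adj0)
  \<comment> \<open>No old vertex reaches \<open>w\<close>, so its walks are those in
    \<open>G\<close>.\<close>
  have lower: "walk_count ?H (w # vs) k (Suc i) = walk_count G vs k i" if "i < ?n" for k i
    using that
  proof (induction k arbitrary: i)
    case (Suc k)
    then show ?case
      by (simp add: walk_count_Suc sum.lessThan_Suc_shift adj adj0 del: sum.lessThan_Suc)
  qed (simp add: walk_count_0)
  \<comment> \<open>Column 0 is deleted, so column \<open>j\<close> of the minor comes from power
    \<open>j + 1\<close>: one factor \<open>?A\<close> more than column \<open>j\<close> of the walk
    matrix of \<open>G\<close>.\<close>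
  have "mat_delete ?W 0 0 = ?A * walk_mat G vs"
  proof (rule eq_matI)
    fix i j assume "i < dim_row (?A * walk_mat G vs)" "j < dim_col (?A * walk_mat G vs)"
    then have ij: "i < ?n" "j < ?n"
      by (simp_all add: adjacency_mat_def walk_mat_eq)
    have "mat_delete ?W 0 0 $$ (i, j) = walk_count G vs (Suc j) i"
      using ij by (simp add: mat_delete_def walk_mat_eq lower)
    also have "\<dots> = (?A * walk_mat G vs) $$ (i, j)"
      using ij adjacency_mat_carrier[of G vs]
      by (auto simp: walk_count_Suc times_mat_def scalar_prod_def lessThan_atLeast0 walk_mat_eq
          simp del: adjacency_mat_carrier intro!: sum.cong)
    finally show "mat_delete ?W 0 0 $$ (i, j) = (?A * walk_mat G vs) $$ (i, j)" .
  qed (simp_all add: mat_delete_def adjacency_mat_def walk_mat_eq)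
  then have minor: "det (mat_delete ?W 0 0) = det ?A * det (walk_mat G vs)"
    by (simp add: det_mult[of _ ?n])
  have "det ?W = (\<Sum>j<Suc ?n. ?W $$ (0, j) * cofactor ?W 0 j)"
    by (rule laplace_expansion_row) (use walk_mat_carrier[of ?H "w # vs"] in simp_all)
  also have "\<dots> = cofactor ?W 0 0"
    by (simp add: sum.lessThan_Suc_shift walk_mat_eq walk_count_0 top del: sum.lessThan_Suc)
  also have "\<dots> = det (mat_delete ?W 0 0)"
    by (simp add: cofactor_def)
  finally show ?thesis
    using minor by simp
qed

section \<open>Passing to the complement\<close>

text \<open>Since \<open>vs\<close> has no repetitions, equal vertices means equal indices; on the
  diagonal the right side is zero because \<open>G\<close> has no loops.\<close>

lemma adjacency_mat_graph_complement:
  assumes G: "pair_graph G" and ord: "vertex_ordering G vs"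
    and ij: "i < length vs" "j < length vs"
  shows "adjacency_mat (graph_complement G) vs $$ (i, j) =
    1 - of_bool (i = j) - adjacency_mat G vs $$ (i, j)"
proof -
  interpret pair_graph G by fact
  have "vs ! i \<in> pverts G" "vs ! j \<in> pverts G" "vs ! i = vs ! j \<longleftrightarrow> i = j"
    using ord ij by (auto simp: vertex_ordering_def nth_eq_iff_index_eq)
  then show ?thesis
    using ij by (auto simp: adjacency_mat_def graph_complement_def dest: pair_no_loops)
qed

text \<open>With B = J - I - A, B v = s e - v - A v, where s is the sum of the entries of v and e =
  A^0 e. Each step raises the degree in A by one and negates the leading coefficient. Being zero
  beyond \<open>k\<close>, \<open>c\<close> can serve as a column of a triangular matrix.\<close>

lemma walk_count_graph_complement:
  assumes G: "pair_graph G" and ord: "vertex_ordering G vs"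
  shows "\<exists>c. c k = (-1) ^ k \<and> (\<forall>l>k. c l = 0) \<and>
    (\<forall>i<length vs. walk_count (graph_complement G) vs k i =
       (\<Sum>l\<le>k. c l * walk_count G vs l i))"
proof (induction k)
  case 0
  show ?case
    by (rule exI[of _ "\<lambda>l. of_bool (l = 0)"]) (simp add: walk_count_0)
next
  case (Suc k)
  let ?n = "length vs" and ?A = "adjacency_mat G vs"
  let ?b = "walk_count (graph_complement G) vs" and ?a = "walk_count G vs"
  from Suc obtain c where ck: "c k = (-1) ^ k" and c0: "\<And>l. l > k \<Longrightarrow> c l = 0"
    and b: "\<And>i. i < ?n \<Longrightarrow> ?b k i = (\<Sum>l\<le>k. c l * ?a l i)"
    by auto
  define s where "s = (\<Sum>j<?n. ?b k j)"
  \<comment> \<open>J contributes \<open>s\<close> to the coefficient of index 0, -I contributes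
    \<open>- c l\<close>, and -A contributes the same coefficients shifted up by one index.\<close>
  define d where "d l = (case l of 0 \<Rightarrow> s - c 0 | Suc m \<Rightarrow> - c (Suc m) - c m)" for l
  have "?b (Suc k) i = (\<Sum>l\<le>Suc k. d l * ?a l i)" if i: "i < ?n" for i
  proof -
    have "(\<Sum>j<?n. ?A $$ (i, j) * ?b k j) = (\<Sum>j<?n. \<Sum>l\<le>k. c l * (?A $$ (i, j) * ?a l j))"
      by (simp add: b sum_distrib_left algebra_simps)
    also have "\<dots> = (\<Sum>l\<le>k. c l * ?a (Suc l) i)"
      using i by (subst sum.swap) (simp add: walk_count_Suc sum_distrib_left)
    finally have Ab: "(\<Sum>j<?n. ?A $$ (i, j) * ?b k j) = (\<Sum>l\<le>k. c l * ?a (Suc l) i)" .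
    have "?b (Suc k) i = (\<Sum>j<?n. ?b k j - of_bool (i = j) * ?b k j - ?A $$ (i, j) * ?b k j)"
      using i
      by (simp add: walk_count_Suc[OF i, of "graph_complement G"] algebra_simps
          adjacency_mat_graph_complement[OF G ord])
    also have "\<dots> = s - ?b k i - (\<Sum>j<?n. ?A $$ (i, j) * ?b k j)"
      using i by (simp add: sum_subtractf s_def of_bool_def sum.delta' if_distrib[of "\<lambda>x. x * _"] cong: if_cong)
    \<comment> \<open>As \<open>c (Suc k) = 0\<close>, the first sum may run to
      \<open>Suc k\<close>, the range of the target.\<close>
    also have "\<dots> = s - (\<Sum>l\<le>Suc k. c l * ?a l i) - (\<Sum>l\<le>k. c l * ?a (Suc l) i)"
      using i by (simp only: Ab) (simp add: b c0)
    also have "\<dots> = (\<Sum>l\<le>Suc k. d l * ?a l i)"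
      using i
      by (simp add: sum.atMost_Suc_shift d_def walk_count_0 algebra_simps sum.distrib sum_negf
          sum_subtractf del: sum.atMost_Suc)
    finally show ?thesis .
  qed
  moreover have "d (Suc k) = (-1) ^ Suc k" "\<forall>l>Suc k. d l = 0"
    by (auto simp: d_def ck c0 split: nat.splits)
  ultimately show ?case by blast
qed

text \<open>Each new column combines old columns of at most the same index, so the change is right
  multiplication by an upper triangular matrix with diagonal entries (-1)^k.\<close>

lemma det_walk_mat_graph_complement:
  assumes G: "pair_graph G" and ord: "vertex_ordering G vs"
  shows "det (walk_mat (graph_complement G) vs) =
    (\<Prod>k<length vs. (-1) ^ k) * det (walk_mat G vs)"
proof -
  let ?n = "length vs"
  obtain c where cd: "\<And>k. c k k = (-1) ^ k" and c0: "\<And>k l. l > k \<Longrightarrow> c k l = 0"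
    and b: "\<And>k i. i < ?n \<Longrightarrow> walk_count (graph_complement G) vs k i =
       (\<Sum>l\<le>k. c k l * walk_count G vs l i)"
    using walk_count_graph_complement[OF G ord] by metis
  define U where "U = mat ?n ?n (\<lambda>(l, k). c k l)"
  have U: "U \<in> carrier_mat ?n ?n" by (simp add: U_def)
  have "walk_mat (graph_complement G) vs = walk_mat G vs * U"
  proof (rule eq_matI)
    fix i k assume "i < dim_row (walk_mat G vs * U)" "k < dim_col (walk_mat G vs * U)"
    then have ik: "i < ?n" "k < ?n" by (simp_all add: walk_mat_eq U_def)
    have "walk_mat (graph_complement G) vs $$ (i, k) = (\<Sum>l\<le>k. c k l * walk_count G vs l i)"
      using ik by (simp add: walk_mat_eq b)
    also have "\<dots> = (\<Sum>l<?n. c k l * walk_count G vs l i)"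
      using ik by (intro sum.mono_neutral_left) (auto simp: c0)
    also have "\<dots> = (walk_mat G vs * U) $$ (i, k)"
      using ik by (auto simp: walk_mat_eq U_def times_mat_def scalar_prod_def lessThan_atLeast0
          intro!: sum.cong)
    finally show "walk_mat (graph_complement G) vs $$ (i, k) = (walk_mat G vs * U) $$ (i, k)" .
  qed (simp_all add: walk_mat_eq U_def)
  moreover have "det U = (\<Prod>k<?n. (-1) ^ k)"
  proof -
    have "upper_triangular U"
      by (auto simp: upper_triangular_def U_def c0)
    then have "det U = prod_list (diag_mat U)"
      by (rule det_upper_triangular) (rule U)
    also have "\<dots> = (\<Prod>k<?n. (-1) ^ k)"
      by (simp add: prod_list_diag_prod U_def cd lessThan_atLeast0)
    finally show ?thesis .
  qed
  ultimately show ?thesis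
    using det_mult[OF walk_mat_carrier U] by simp
qed

section \<open>Adding a dominating vertex\<close>

text \<open>Complementing twice restores the arcs among old vertices, since those arcs avoid loops
  and stay within \<open>pverts G\<close>; the outer complement joins the isolated \<open>w\<close>
  to every old vertex.\<close>

lemma add_dominating_eq_graph_complement:
  assumes "pair_graph G" "w \<notin> pverts G"
  shows "add_dominating G w = graph_complement (add_isolated (graph_complement G) w)"
proof -
  interpret pair_graph G by fact
  show ?thesis
    using assms(2)
    by (auto simp: add_dominating_def add_isolated_def graph_complement_def
        dest: in_arcsD1 in_arcsD2 pair_no_loops)
qed

lemma det_walk_mat_add_dominating:
  assumes G: "pair_graph G" and ord: "vertex_ordering G vs" and w: "w \<notin> pverts G"
  shows "det (walk_mat (add_dominating G w) (w # vs)) =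
    (-1) ^ length vs * det (adjacency_mat (graph_complement G) vs) * det (walk_mat G vs)"
proof -
  let ?C = "graph_complement G"
  \<comment> \<open>The sign of complementing on n vertices (the inner complement); the outer one
    acts on n + 1 vertices and gives \<open>P * (-1) ^ length vs\<close>. The two copies of
    \<open>P\<close> cancel.\<close>
  define P :: int where "P = (\<Prod>k<length vs. (-1) ^ k)"
  have C: "pair_graph ?C" "vertex_ordering ?C vs" "w \<notin> pverts ?C"
    using G ord w pair_graph_graph_complement
    by (auto simp: vertex_ordering_def graph_complement_def)
  have "vertex_ordering (add_isolated ?C w) (w # vs)"
    using C by (auto simp: vertex_ordering_def add_isolated_def)
  then have "det (walk_mat (add_dominating G w) (w # vs)) =
      (P * (-1) ^ length vs) * (det (adjacency_mat ?C vs) * (P * det (walk_mat G vs)))"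
    by (simp add: P_def add_dominating_eq_graph_complement[OF G w] det_walk_mat_graph_complement
        pair_graph_add_isolated C(1) det_walk_mat_add_isolated[OF C(1,3)] G ord)
  also have "\<dots> = (P * P) * ((-1) ^ length vs * det (adjacency_mat ?C vs) * det (walk_mat G vs))"
    by (simp only: ac_simps)
  also have "P * P = 1"
    by (simp add: P_def flip: prod.distrib power_mult_distrib)
  finally show ?thesis
    by simp
qed

text \<open>The signs are chosen before the graph, so they depend only on \<open>n\<close> and the
  position \<open>k\<close>. With \<open>w\<close> first, the join formula without (-1)^n would fail
  for odd \<open>n\<close> whenever both determinants on the right are nonzero.\<close>

theorem theorem2p4:
  fixes n :: nat
  shows "(\<exists>\<sigma> \<tau> :: nat \<Rightarrow> int.
           (\<forall>k. (\<sigma> k = 1 \<or> \<sigma> k = -1) \<and> (\<tau> k = 1 \<or> \<tau> k = -1)) \<and>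
           (\<forall>(G :: 'a pair_pre_digraph) vs w k.
              pair_graph G \<and> card (pverts G) = n \<and> vertex_ordering G vs \<and> w \<notin> pverts G \<and> k \<le> n \<longrightarrow>
              det (walk_mat (add_isolated G w) (insert_at k w vs)) =
                \<sigma> k * det (adjacency_mat G vs) * det (walk_mat G vs) \<and>
              det (walk_mat (add_dominating G w) (insert_at k w vs)) =
                \<tau> k * det (adjacency_mat (graph_complement G) vs) * det (walk_mat G vs))) \<and>
         (\<forall>(G :: 'a pair_pre_digraph) vs w.
           pair_graph G \<and> card (pverts G) = n \<and> vertex_ordering G vs \<and> w \<notin> pverts G \<longrightarrow>
           det (walk_mat (add_isolated G w) (w # vs)) =
             det (adjacency_mat G vs) * det (walk_mat G vs) \<and>
           det (walk_mat (add_dominating G w) (w # vs)) =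
             (-1) ^ n * det (adjacency_mat (graph_complement G) vs) * det (walk_mat G vs))"
proof (intro conjI exI allI impI)
  fix k
  \<comment> \<open>Moving \<open>w\<close> from the front to position \<open>k\<close> costs the
    sign of the cycle; the join also carries (-1)^n.\<close>
  let ?\<sigma> = "\<lambda>k. sign (insert_perm k)" and ?\<tau> = "\<lambda>k. sign (insert_perm k) * (-1) ^ n"
  show "?\<sigma> k = 1 \<or> ?\<sigma> k = -1" by (simp add: sign_def)
  show "?\<tau> k = 1 \<or> ?\<tau> k = -1" by (cases "even n") (simp_all add: sign_def)
next
  fix G :: "'a pair_pre_digraph" and vs w k
  assume "pair_graph G \<and> card (pverts G) = n \<and> vertex_ordering G vs \<and> w \<notin> pverts G \<and> k \<le> n"
  then have G: "pair_graph G" "vertex_ordering G vs" "w \<notin> pverts G"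
    and "length vs = n" "k \<le> length vs"
    by (auto simp: vertex_ordering_def distinct_card[symmetric])
  then show "det (walk_mat (add_isolated G w) (insert_at k w vs)) =
      sign (insert_perm k) * det (adjacency_mat G vs) * det (walk_mat G vs)"
    and "det (walk_mat (add_dominating G w) (insert_at k w vs)) =
      sign (insert_perm k) * (-1) ^ n * det (adjacency_mat (graph_complement G) vs) *
      det (walk_mat G vs)"
    by (simp_all add: det_walk_mat_insert_at det_walk_mat_add_isolated
        det_walk_mat_add_dominating)
next
  fix G :: "'a pair_pre_digraph" and vs w
  assume "pair_graph G \<and> card (pverts G) = n \<and> vertex_ordering G vs \<and> w \<notin> pverts G"
  then have G: "pair_graph G" "vertex_ordering G vs" "w \<notin> pverts G" and "length vs = n"
    by (auto simp: vertex_ordering_def distinct_card[symmetric])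
  then show "det (walk_mat (add_isolated G w) (w # vs)) =
      det (adjacency_mat G vs) * det (walk_mat G vs)"
    and "det (walk_mat (add_dominating G w) (w # vs)) =
      (-1) ^ n * det (adjacency_mat (graph_complement G) vs) * det (walk_mat G vs)"
    by (simp_all add: det_walk_mat_add_isolated det_walk_mat_add_dominating)
qed

end
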